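(* Let $\mathbf p=(\mathbf p_1,\dots,\mathbf p_N)$ and $\mathbf q=(\mathbf q_1,\dots,\mathbf q_N)$ be two configurations of points in the plane $\mathbb E^2$ such that $\mathbf q$ is an arbitrary expansion of $\mathbf p$, i.e. $|\mathbf p_i-\mathbf p_j|\le|\mathbf q_i-\mathbf q_j|$ for all $1\le i<j\le N$. Then for all radii $r_1,\dots,r_N\ge 0$, $$\mathrm{Vol}_2\Big[\bigcup_{i=1}^N B(\mathbf p_i,r_i)\Big]\le \mathrm{Vol}_2\Big[\bigcup_{i=1}^N B(\mathbf q_i,r_i)\Big]$$ and $$\mathrm{Vol}_2\Big[\bigcap_{i=1}^N B(\mathbf p_i,r_i)\Big]\ge \mathrm{Vol}_2\Big[\bigcap_{i=1}^N B(\mathbf q_i,r_i)\Big].$$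
   Context: $\mathbb E^2$ is the Euclidean plane with norm $|\cdot|$; $B(\mathbf x,r)$ is the closed disk of radius $r\ge 0$ about $\mathbf x$; $\mathrm{Vol}_2$ is area. A configuration is a finite tuple of points. *)

theory Defs
  imports "HOL-Analysis.Analysis"
begin

end

theory Submission
  imports Defs "HOL-Probability.Distributions"
begin

text \<open>
  The union of the disks is the limit, as \<open>\<beta> \<rightarrow> \<infinity>\<close>, of the functions \<open>1 - exp (- G)\<close> for the
  Gaussian mixture \<open>G x = (\<Sum>i. exp (\<beta> (r\<^sub>i\<^sup>2 - |x - p\<^sub>i|\<^sup>2)))\<close>, and the intersection is the limit of
  \<open>exp (- G)\<close> as \<open>\<beta> \<rightarrow> - \<infinity>\<close>. Adding two dimensions and integrating them out in polar
  coordinates turns the integrals of these functions over the plane into the integral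
  \<open>J = \<integral> G exp (- G)\<close> over \<open>\<real>\<^sup>4\<close>, up to constants. In \<open>\<real>\<^sup>4 = \<real>\<^sup>2 \<times> \<real>\<^sup>2\<close> the points
  \<open>P\<^sub>i(t) = (cos t p\<^sub>i, sin t q\<^sub>i)\<close> join \<open>(p, 0)\<close> to \<open>(0, q)\<close> along an expansion, and integration by
  parts gives, with \<open>g\<^sub>i\<close> denoting the summands of \<open>G\<close>,
  \<open>J' = \<beta> \<integral> exp (- G) (\<Sum>i j. g\<^sub>i g\<^sub>j (P\<^sub>i - P\<^sub>j) \<bullet> (P\<^sub>i' - P\<^sub>j'))\<close>. Hence \<open>J\<close> increases
  for \<open>\<beta> > 0\<close> and decreases for \<open>\<beta> < 0\<close>.
\<close>

section \<open>Gaussian integrals and differentiation under the integral\<close>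

lemma integrable_gaussian_real:
  fixes a :: real
  assumes "a > 0"
  shows "integrable lborel (\<lambda>x::real. exp (- (a * x\<^sup>2)))"
proof -
  have "has_bochner_integral lborel (\<lambda>x::real. exp (- x\<^sup>2)) (2 *\<^sub>R (sqrt pi / 2))"
    using has_bochner_integral_even_function[OF gaussian_moment_0] by simp
  hence "integrable lborel (\<lambda>x::real. exp (- x\<^sup>2))"
    by (simp add: has_bochner_integral_iff)
  from lborel_integrable_real_affine[OF this, of "sqrt a" 0] show ?thesis
    using assms by (simp add: power_mult_distrib)
qed

text \<open>Lebesgue measure is the image of a product of line measures indexed by
  \<open>Basis\<close>, and there the Gaussian factors into one-dimensional ones.\<close>

lemma integrable_gaussian:
  fixes a :: real
  assumes "a > 0"
  shows "integrable lborel (\<lambda>x::'a::euclidean_space. exp (- (a * (norm x)\<^sup>2)))"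
proof -
  interpret product_sigma_finite "\<lambda>_::'a. lborel :: real measure" ..
  have "integrable (\<Pi>\<^sub>M b\<in>(Basis::'a set). lborel)
          (\<lambda>f. \<Prod>b\<in>Basis. exp (- (a * (f b)\<^sup>2)))"
    using integrable_gaussian_real[OF assms] by (intro product_integrable_prod) auto
  also have "(\<lambda>f. \<Prod>b\<in>(Basis::'a set). exp (- (a * (f b)\<^sup>2))) =
             (\<lambda>f. exp (- (a * (norm (\<Sum>b\<in>(Basis::'a set). f b *\<^sub>R b))\<^sup>2)))"
  proof
    fix f :: "'a \<Rightarrow> real"
    have "(norm (\<Sum>b\<in>(Basis::'a set). f b *\<^sub>R b))\<^sup>2 = (\<Sum>b\<in>(Basis::'a set). (f b)\<^sup>2)"
      by (simp only: power2_norm_eq_inner) (subst euclidean_inner, simp add: power2_eq_square)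
    thus "(\<Prod>b\<in>(Basis::'a set). exp (- (a * (f b)\<^sup>2))) =
            exp (- (a * (norm (\<Sum>b\<in>(Basis::'a set). f b *\<^sub>R b))\<^sup>2))"
      by (simp add: exp_sum sum_distrib_left flip: sum_negf)
  qed
  finally show ?thesis
    by (subst lborel_eq, subst integrable_distr_eq) simp_all
qed

lemma integrable_gaussian_shift:
  fixes a :: real and c :: "'a::euclidean_space"
  assumes "a > 0"
  shows "integrable lborel (\<lambda>x. exp (- (a * (norm (x - c))\<^sup>2)))"
proof -
  have "integrable (distr lborel borel ((+) (-c))) (\<lambda>x::'a. exp (- (a * (norm x)\<^sup>2)))"
    by (simp add: lborel_distr_plus integrable_gaussian[OF assms])
  thus ?thesis
    by (subst (asm) integrable_distr_eq) auto
qed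

text \<open>Half of the exponent absorbs the factor \<open>norm x\<close>, by
  \<open>n \<le> 1 + n\<^sup>2\<close> and \<open>u < exp u\<close>.\<close>

lemma integrable_norm_gaussian:
  fixes a :: real
  assumes "a > 0"
  shows "integrable lborel (\<lambda>x::'a::euclidean_space. norm x * exp (- (a * (norm x)\<^sup>2)))"
proof (rule Bochner_Integration.integrable_bound)
  show "integrable lborel (\<lambda>x::'a. (1 + 2 / a) * exp (- (a / 2 * (norm x)\<^sup>2)))"
    using assms by (intro integrable_mult_right integrable_gaussian) auto
  show "AE x::'a in lborel. norm (norm x * exp (- (a * (norm x)\<^sup>2)))
           \<le> norm ((1 + 2 / a) * exp (- (a / 2 * (norm x)\<^sup>2)))"
  proof (intro AE_I2)
    fix x :: 'a
    define n where "n = norm x"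
    have n: "n \<ge> 0" by (simp add: n_def)
    have "n \<le> 1 + n\<^sup>2"
      using sum_squares_ge_zero[of "n - 1/2" 0] by (simp add: power2_eq_square algebra_simps)
    also have "n\<^sup>2 = 2 / a * (a / 2 * n\<^sup>2)" using assms by simp
    also have "1 + 2 / a * (a / 2 * n\<^sup>2) \<le> exp (a / 2 * n\<^sup>2) + 2 / a * exp (a / 2 * n\<^sup>2)"
      using assms less_imp_le[OF exp_gt_self] by (intro add_mono mult_left_mono) auto
    finally have "n * exp (- (a * n\<^sup>2)) \<le> (1 + 2 / a) * exp (a / 2 * n\<^sup>2) * exp (- (a * n\<^sup>2))"
      by (intro mult_right_mono) (auto simp: algebra_simps)
    also have "\<dots> = (1 + 2 / a) * exp (a / 2 * n\<^sup>2 + - (a * n\<^sup>2))"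
      by (simp only: exp_add mult.assoc)
    also have "a / 2 * n\<^sup>2 + - (a * n\<^sup>2) = - (a / 2 * n\<^sup>2)"
      by (simp add: field_simps)
    finally show "norm (norm x * exp (- (a * (norm x)\<^sup>2)))
           \<le> norm ((1 + 2 / a) * exp (- (a / 2 * (norm x)\<^sup>2)))"
      using n assms by (simp add: n_def abs_mult)
  qed
qed simp

text \<open>This replaces polar coordinates: the disk of radius \<open>sqrt \<rho>\<close> has area
  \<open>pi * \<rho>\<close>, so the squared norm pushes area forward to \<open>pi\<close> times
  Lebesgue measure on the half-line.\<close>

lemma nn_integral_norm_sq_plane:
  fixes f :: "real \<Rightarrow> ennreal"
  assumes dim: "DIM('a::euclidean_space) = 2" and [measurable]: "f \<in> borel_measurable borel"
  shows "(\<integral>\<^sup>+y. f ((norm (y::'a))\<^sup>2) \<partial>lborel) = pi * (\<integral>\<^sup>+\<rho>. f \<rho> * indicator {0..} \<rho> \<partial>lborel)"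
proof -
  \<comment> \<open>The minus sign makes the preimages of the rays \<open>{x<..}\<close> disks or
    empty, hence of finite measure, as the comparison of measures on such rays requires.\<close>
  define M where "M = distr lborel borel (\<lambda>y::'a. - (norm y)\<^sup>2)"
  define D where "D = density lborel (\<lambda>u::real. ennreal pi * indicator {..0} u)"
  have "M = D"
  proof (rule measure_eqI_lessThan)
    have M: "emeasure M {x<..} = ennreal (pi * max 0 (- x))" for x
    proof -
      have "emeasure M {x<..} = emeasure lborel ((\<lambda>y::'a. - (norm y)\<^sup>2) -` {x<..})"
        by (simp add: M_def emeasure_distr)
      also have "(\<lambda>y::'a. - (norm y)\<^sup>2) -` {x<..} = (if x < 0 then ball 0 (sqrt (- x)) else {})"
      proof (cases "x < 0")
        case True
        have "x < - (norm y)\<^sup>2 \<longleftrightarrow> norm y < sqrt (- x)" for y :: 'a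
          using True real_sqrt_less_iff[of "(norm y)\<^sup>2" "- x"] by auto
        thus ?thesis using True by auto
      next
        case False
        thus ?thesis by (auto simp: not_less) (smt (verit) zero_le_power2)
      qed
      also have "emeasure lborel \<dots> = ennreal (pi * max 0 (- x))"
        by (simp add: emeasure_ball dim unit_ball_vol_numeral)
      finally show ?thesis .
    qed
    thus "emeasure M {x<..} < \<infinity>" for x by simp
    show "emeasure M {x<..} = emeasure D {x<..}" for x
    proof -
      have "emeasure D {x<..} = (\<integral>\<^sup>+u. ennreal pi * indicator {x<..0} u \<partial>lborel)"
        by (auto simp: D_def emeasure_density intro!: nn_integral_cong split: split_indicator)
      also have "\<dots> = ennreal pi * emeasure lborel {x<..0}"
        by (rule nn_integral_cmult_indicator) simp
      also have "\<dots> = ennreal (pi * max 0 (- x))"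
        by (cases "x \<le> 0") (auto simp flip: ennreal_mult')
      finally show ?thesis using M by simp
    qed
  qed (simp_all add: M_def D_def)
  have "(\<integral>\<^sup>+y. f ((norm (y::'a))\<^sup>2) \<partial>lborel) = (\<integral>\<^sup>+u. f (- u) \<partial>M)"
    by (simp add: M_def nn_integral_distr)
  also have "\<dots> = (\<integral>\<^sup>+u. ennreal pi * (f (- u) * indicator {..0} u) \<partial>lborel)"
    unfolding \<open>M = D\<close> D_def by (subst nn_integral_density) (auto simp: mult_ac)
  also have "\<dots> = ennreal pi * (\<integral>\<^sup>+u. f (- u) * indicator {..0} u \<partial>lborel)"
    by (rule nn_integral_cmult) simp
  also have "(\<integral>\<^sup>+u. f (- u) * indicator {..0} u \<partial>lborel) = (\<integral>\<^sup>+\<rho>. f \<rho> * indicator {0..} \<rho> \<partial>lborel)"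
    by (subst nn_integral_real_affine[where c = "-1" and t = 0])
       (auto intro!: nn_integral_cong split: split_indicator)
  finally show ?thesis .
qed

text \<open>The fundamental theorem of calculus in \<open>t\<close> for each fixed \<open>z\<close>,
  followed by Fubini. The integrated form avoids differentiating a parameter integral.\<close>

lemma integral_diff_eq_integral_deriv:
  fixes f f' :: "real \<Rightarrow> 'a::euclidean_space \<Rightarrow> real"
  assumes ab: "a \<le> b"
    and deriv: "\<And>t z. ((\<lambda>t. f t z) has_field_derivative f' t z) (at t)"
    and cont: "continuous_on UNIV (\<lambda>(t, z). f' t z)"
    and bound: "\<And>t z. a \<le> t \<Longrightarrow> t \<le> b \<Longrightarrow> \<bar>f' t z\<bar> \<le> D z"
    and D: "integrable lborel D"
    and int: "integrable lborel (f a)" "integrable lborel (f b)"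
  shows "(\<integral>z. f b z \<partial>lborel) - (\<integral>z. f a z \<partial>lborel)
           = (\<integral>t. indicator {a..b} t * (\<integral>z. f' t z \<partial>lborel) \<partial>lborel)"
proof -
  define h where "h = (\<lambda>t z. indicator {a..b} t * f' t z)"
  have cont_t: "isCont (\<lambda>t. f' t z) t" for t z
  proof -
    have "continuous_on UNIV ((\<lambda>(t, z). f' t z) \<circ> (\<lambda>t. (t, z)))"
      by (intro continuous_on_compose continuous_on_subset[OF cont] continuous_intros) auto
    thus ?thesis by (simp add: o_def continuous_on_eq_continuous_at)
  qed
  have cont_z: "continuous_on UNIV (f' t)" for t
  proof -
    have "continuous_on UNIV ((\<lambda>(t, z). f' t z) \<circ> (\<lambda>z. (t, z)))"
      by (intro continuous_on_compose continuous_on_subset[OF cont] continuous_intros) auto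
    thus ?thesis by (simp add: o_def)
  qed
  have [measurable]: "(\<lambda>(t, z). f' t z) \<in> borel_measurable (lborel \<Otimes>\<^sub>M lborel)"
    using borel_measurable_continuous_onI[OF cont] by (simp add: lborel_prod)
  have meas: "(\<lambda>(t, z). h t z) \<in> borel_measurable (lborel \<Otimes>\<^sub>M lborel)"
    unfolding h_def by measurable
  have [measurable]: "f' t \<in> borel_measurable borel" for t
    by (rule borel_measurable_continuous_onI[OF cont_z])
  have Dint: "integrable lborel (f' t)" if "a \<le> t" "t \<le> b" for t
    using bound[OF that] order_trans[OF _ abs_ge_self]
    by (intro Bochner_Integration.integrable_bound[OF D]) auto
  \<comment> \<open>The integrals over \<open>z\<close> of the absolute value are at most the
    integral of \<open>D\<close> for \<open>t\<close> in \<open>[a, b]\<close> and vanish for other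
    \<open>t\<close>.\<close>
  have h_int: "integrable (lborel \<Otimes>\<^sub>M lborel) (\<lambda>(t, z). h t z)"
  proof (rule lborel_pair.Fubini_integrable[OF meas])
    have m: "(\<lambda>t. \<integral>z. norm (h t z) \<partial>lborel) \<in> borel_measurable lborel"
      using meas by (intro lborel.borel_measurable_lebesgue_integral) (simp add: case_prod_beta)
    have "integrable lborel (\<lambda>t. \<integral>z. norm (h t z) \<partial>lborel)"
    proof (rule Bochner_Integration.integrable_bound)
      show "integrable lborel (\<lambda>t. indicator {a..b} t * (\<integral>z. D z \<partial>lborel))"
        using ab by (intro integrable_mult_left integrable_real_indicator) auto
      have "norm (\<integral>z. norm (h t z) \<partial>lborel) \<le> norm (indicator {a..b} t * (\<integral>z. D z \<partial>lborel))" for t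
      proof (cases "t \<in> {a..b}")
        case True
        have "(\<integral>z. \<bar>f' t z\<bar> \<partial>lborel) \<le> (\<integral>z. D z \<partial>lborel)"
          using True Dint D bound by (intro integral_mono) auto
        thus ?thesis using True by (simp add: h_def)
      qed (simp add: h_def)
      thus "AE t in lborel. norm (\<integral>z. norm (h t z) \<partial>lborel)
              \<le> norm (indicator {a..b} t * (\<integral>z. D z \<partial>lborel))" by simp
    qed (fact m)
    thus "integrable lborel (\<lambda>t. \<integral>z. norm (case (t, z) of (t, z) \<Rightarrow> h t z) \<partial>lborel)" by simp
    show "AE t in lborel. integrable lborel (\<lambda>z. case (t, z) of (t, z) \<Rightarrow> h t z)"
      using Dint by (intro AE_I2) (auto simp: h_def split: split_indicator)
  qed
  have "(\<integral>z. f b z \<partial>lborel) - (\<integral>z. f a z \<partial>lborel) = (\<integral>z. f b z - f a z \<partial>lborel)"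
    using int by simp
  also have "\<dots> = (\<integral>z. (\<integral>t. h t z \<partial>lborel) \<partial>lborel)"
    unfolding h_def
    using integral_FTC_Icc_real[OF ab, of "\<lambda>t. f t z" "\<lambda>t. f' t z" for z, OF deriv cont_t]
    by (simp add: mult.commute)
  also have "\<dots> = (\<integral>t. (\<integral>z. h t z \<partial>lborel) \<partial>lborel)"
    by (rule lborel_pair.Fubini_integral[OF h_int])
  finally show ?thesis by (simp add: h_def)
qed

lemma lborel_integral_shift:
  fixes f :: "'a::euclidean_space \<Rightarrow> real"
  assumes [measurable]: "f \<in> borel_measurable borel"
  shows "(\<integral>x. f (x + c) \<partial>lborel) = (\<integral>x. f x \<partial>lborel)"
proof -
  have "(\<integral>x. f x \<partial>lborel) = (\<integral>x. f x \<partial>distr lborel borel ((+) c))"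
    by (simp add: lborel_distr_plus)
  also have "\<dots> = (\<integral>x. f (c + x) \<partial>lborel)"
    by (rule integral_distr) auto
  finally show ?thesis by (simp add: add.commute)
qed

lemma lborel_integrable_shift:
  fixes f :: "'a::euclidean_space \<Rightarrow> real"
  assumes "integrable lborel f"
  shows "integrable lborel (\<lambda>x. f (x + c))"
proof -
  have "integrable (distr lborel borel ((+) c)) f"
    using assms by (simp add: lborel_distr_plus)
  thus ?thesis
    using borel_measurable_integrable[OF assms]
    by (subst (asm) integrable_distr_eq) (auto simp: add.commute)
qed

text \<open>Integration by parts without boundary terms: by translation invariance the integral of
  \<open>h (z + t v)\<close> is the same at \<open>t = 0\<close> and \<open>t = 1\<close>, and that
  of \<open>h' (z + t v)\<close> does not depend on \<open>t\<close>.\<close>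

lemma integral_directional_deriv_eq_0:
  fixes h h' :: "'a::euclidean_space \<Rightarrow> real"
  assumes deriv: "\<And>z t. ((\<lambda>t. h (z + t *\<^sub>R v)) has_field_derivative h' (z + t *\<^sub>R v)) (at t)"
    and cont: "continuous_on UNIV h'"
    and bound: "\<And>t z. 0 \<le> t \<Longrightarrow> t \<le> 1 \<Longrightarrow> \<bar>h' (z + t *\<^sub>R v)\<bar> \<le> D z"
    and D: "integrable lborel D" and h: "integrable lborel h"
  shows "(\<integral>z. h' z \<partial>lborel) = 0"
proof -
  have [measurable]: "h \<in> borel_measurable borel" "h' \<in> borel_measurable borel"
    using borel_measurable_integrable[OF h] borel_measurable_continuous_onI[OF cont] by auto
  have "continuous_on UNIV (h' \<circ> (\<lambda>(t, z). z + t *\<^sub>R v))"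
    by (intro continuous_on_compose continuous_on_subset[OF cont])
       (auto simp: case_prod_beta intro!: continuous_intros)
  hence "(\<integral>z. h (z + 1 *\<^sub>R v) \<partial>lborel) - (\<integral>z. h (z + 0 *\<^sub>R v) \<partial>lborel)
           = (\<integral>t. indicator {0..1} t * (\<integral>z. h' (z + t *\<^sub>R v) \<partial>lborel) \<partial>lborel)"
    using lborel_integrable_shift[OF h]
    by (intro integral_diff_eq_integral_deriv[OF _ deriv _ bound D])
       (auto simp: o_def case_prod_beta h)
  thus ?thesis by (simp add: lborel_integral_shift)
qed

text \<open>Halving the exponent bounds all Gaussians with centres in a fixed ball by one Gaussian
  centred at the origin.\<close>

lemma exp_gaussian_shift_le:
  fixes b R :: real and z P :: "'a::real_normed_vector"
  assumes "b \<ge> 0" "norm P \<le> R"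
  shows "exp (- (b * (norm (z - P))\<^sup>2)) \<le> exp (b * R\<^sup>2) * exp (- (b / 2 * (norm z)\<^sup>2))"
proof -
  have "norm z \<le> norm (z - P) + R"
    using norm_triangle_ineq[of "z - P" P] assms(2) by simp
  hence "(norm z)\<^sup>2 \<le> (norm (z - P) + R)\<^sup>2"
    by (intro power_mono) auto
  also have "\<dots> \<le> 2 * (norm (z - P))\<^sup>2 + 2 * R\<^sup>2"
    using zero_le_power2[of "norm (z - P) - R"] by (simp add: power2_eq_square algebra_simps)
  finally have "b / 2 * (norm z)\<^sup>2 \<le> b / 2 * (2 * (norm (z - P))\<^sup>2 + 2 * R\<^sup>2)"
    using assms(1) by (intro mult_left_mono) auto
  thus ?thesis
    by (simp add: algebra_simps flip: exp_add)
qed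

text \<open>The first bound serves \<open>\<beta> > 0\<close>, where the mixture decays at infinity,
  the second \<open>\<beta> < 0\<close>, where it blows up.\<close>

lemma mult_exp_neg_bounds:
  fixes x :: real
  assumes "x > 0"
  shows "x * (1 + x) * exp (- x) \<le> x" "x * (1 + x) * exp (- x) \<le> 31 / x"
proof -
  have "x * ((1 + x) * exp (- x)) \<le> x * 1"
    using assms exp_ge_add_one_self[of x]
    by (intro mult_left_mono) (auto simp: exp_minus field_simps)
  thus "x * (1 + x) * exp (- x) \<le> x" by (simp add: mult.assoc)
  \<comment> \<open>Powers of \<open>y < exp y\<close> at \<open>y = x / 2\<close> and
    \<open>y = x / 3\<close> give the constants 4 and 27, whose sum is 31.\<close>
  have "(x / 2)\<^sup>2 \<le> (exp (x / 2))\<^sup>2"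
    using assms by (intro power_mono less_imp_le[OF exp_gt_self]) simp
  hence 2: "x\<^sup>2 \<le> 4 * exp x"
    by (simp add: power_divide flip: exp_of_nat_mult)
  have "(x / 3) ^ 3 \<le> (exp (x / 3)) ^ 3"
    using assms by (intro power_mono less_imp_le[OF exp_gt_self]) simp
  hence 3: "x ^ 3 \<le> 27 * exp x"
    by (simp add: power_divide flip: exp_of_nat_mult)
  have "x * (x * (1 + x)) \<le> 31 * exp x"
    using 2 3 by (simp add: power2_eq_square power3_eq_cube algebra_simps)
  thus "x * (1 + x) * exp (- x) \<le> 31 / x"
    using assms by (simp add: exp_minus field_simps)
qed

lemma abs_inner_le:
  fixes z P v :: "'a::euclidean_space"
  assumes "norm P \<le> R" "norm v \<le> V"
  shows "\<bar>(z - P) \<bullet> v\<bar> \<le> (norm z + R) * V"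
proof -
  have "norm (z - P) \<le> norm z + R"
    using norm_triangle_ineq4[of z P] assms(1) by linarith
  have "\<bar>(z - P) \<bullet> v\<bar> \<le> norm (z - P) * norm v" by (rule Cauchy_Schwarz_ineq2)
  also have "\<dots> \<le> (norm z + R) * V"
    using assms(2) \<open>norm (z - P) \<le> norm z + R\<close> order_trans[OF norm_ge_zero]
    by (intro mult_mono) auto
  finally show ?thesis .
qed

section \<open>Gaussian mixtures\<close>

locale gaussian_mixture =
  fixes I :: "'i set" and c :: "'i \<Rightarrow> real" and \<beta> :: real
  assumes finite_I: "finite I" and I_nonempty: "I \<noteq> {}"
    and c_pos: "\<And>i. i \<in> I \<Longrightarrow> c i > 0" and \<beta>_nonzero: "\<beta> \<noteq> 0"
begin

definition g :: "'i \<Rightarrow> 'a::euclidean_space \<Rightarrow> 'a \<Rightarrow> real" where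
  "g i P z = c i * exp (- (\<beta> * (norm (z - P))\<^sup>2))"

definition G :: "('i \<Rightarrow> 'a::euclidean_space) \<Rightarrow> 'a \<Rightarrow> real" where
  "G P z = (\<Sum>i\<in>I. g i (P i) z)"

lemma g_pos: "i \<in> I \<Longrightarrow> g i P z > 0"
  by (simp add: g_def c_pos)

lemma g_nonneg: "i \<in> I \<Longrightarrow> g i P z \<ge> 0"
  by (simp add: g_pos less_imp_le)

lemma G_pos: "G P z > 0"
  unfolding G_def using finite_I I_nonempty g_pos by (intro sum_pos) auto

lemma G_nonneg: "G P z \<ge> 0"
  by (rule less_imp_le[OF G_pos])

lemma g_le_G: "i \<in> I \<Longrightarrow> g i (P i) z \<le> G P z"
  unfolding G_def using finite_I g_nonneg
  by (intro member_le_sum) auto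

lemma g_shift: "g i P (z + w) = g i (P - w) z"
  by (simp add: g_def algebra_simps)

lemma G_shift: "G P (z + w) = G (\<lambda>i. P i - w) z"
  by (simp add: G_def g_shift)

lemma continuous_on_g [continuous_intros]:
  "continuous_on S p \<Longrightarrow> continuous_on S q \<Longrightarrow> continuous_on S (\<lambda>x. g i (p x) (q x))"
  unfolding g_def by (intro continuous_intros)

lemma continuous_on_G [continuous_intros]:
  "(\<And>i. i \<in> I \<Longrightarrow> continuous_on S (\<lambda>x. p x i)) \<Longrightarrow> continuous_on S q
    \<Longrightarrow> continuous_on S (\<lambda>x. G (p x) (q x))"
  unfolding G_def by (intro continuous_intros)

lemma measurable_G [measurable]: "G P \<in> borel_measurable borel"
  by (intro borel_measurable_continuous_onI continuous_intros)

lemma measurable_g [measurable]: "g i p \<in> borel_measurable borel"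
  by (intro borel_measurable_continuous_onI continuous_intros)

section \<open>Derivatives with respect to the centres\<close>

lemma deriv_g:
  fixes P :: "real \<Rightarrow> 'a::euclidean_space"
  assumes "(P has_vector_derivative P') (at t)"
  shows "((\<lambda>t. g i (P t) z) has_field_derivative 2 * \<beta> * (g i (P t) z * ((z - P t) \<bullet> P'))) (at t)"
proof -
  have "((\<lambda>t. (z - P t) \<bullet> (z - P t)) has_derivative
          (\<lambda>h. (z - P t) \<bullet> (0 - h *\<^sub>R P') + (0 - h *\<^sub>R P') \<bullet> (z - P t))) (at t)"
    using assms unfolding has_vector_derivative_def by (intro derivative_intros)
  hence sq: "((\<lambda>t. (norm (z - P t))\<^sup>2) has_field_derivative - 2 * ((z - P t) \<bullet> P')) (at t)"
    unfolding has_field_derivative_def power2_norm_eq_inner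
    by (rule has_derivative_eq_rhs) (simp add: fun_eq_iff inner_commute algebra_simps)
  show ?thesis
    unfolding g_def
    by (rule DERIV_cong[OF DERIV_cmult[OF DERIV_fun_exp[OF DERIV_minus[OF DERIV_cmult[OF sq]]]]])
       (simp add: algebra_simps)
qed

lemma deriv_G:
  fixes P :: "'i \<Rightarrow> real \<Rightarrow> 'a::euclidean_space"
  assumes "\<And>i. i \<in> I \<Longrightarrow> (P i has_vector_derivative P' i) (at t)"
  shows "((\<lambda>t. G (\<lambda>i. P i t) z) has_field_derivative
           2 * \<beta> * (\<Sum>i\<in>I. g i (P i t) z * ((z - P i t) \<bullet> P' i))) (at t)"
  unfolding G_def sum_distrib_left using assms by (intro DERIV_sum deriv_g) auto

section \<open>Integrable majorants uniform in the centres\<close>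

text \<open>\<open>K\<close> depends on \<open>R\<close> but not on \<open>P\<close>, so the bound
  holds along a whole bounded motion of the centres.\<close>

lemma profile_bound:
  obtains K where "K \<ge> 0"
    "\<And>P z. (\<And>i. i \<in> I \<Longrightarrow> norm (P i :: 'a::euclidean_space) \<le> R) \<Longrightarrow>
       G P z * (1 + G P z) * exp (- G P z) \<le> K * exp (- (\<bar>\<beta>\<bar> / 2 * (norm z)\<^sup>2))"
proof (cases "\<beta> > 0")
  case True
  show ?thesis
  proof (rule that[of "(\<Sum>i\<in>I. c i) * exp (\<beta> * R\<^sup>2)"])
    show "(\<Sum>i\<in>I. c i) * exp (\<beta> * R\<^sup>2) \<ge> 0"
      using c_pos by (intro mult_nonneg_nonneg sum_nonneg) (auto intro: less_imp_le)
    fix P :: "'i \<Rightarrow> 'a" and z :: 'a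
    assume P: "\<And>i. i \<in> I \<Longrightarrow> norm (P i) \<le> R"
    have "G P z * (1 + G P z) * exp (- G P z) \<le> G P z"
      using mult_exp_neg_bounds(1) G_pos by blast
    also have "\<dots> \<le> (\<Sum>i\<in>I. c i * (exp (\<beta> * R\<^sup>2) * exp (- (\<beta> / 2 * (norm z)\<^sup>2))))"
      unfolding G_def g_def using c_pos[THEN less_imp_le] True P
      by (intro sum_mono mult_left_mono exp_gaussian_shift_le) auto
    finally show "G P z * (1 + G P z) * exp (- G P z)
        \<le> (\<Sum>i\<in>I. c i) * exp (\<beta> * R\<^sup>2) * exp (- (\<bar>\<beta>\<bar> / 2 * (norm z)\<^sup>2))"
      using True by (simp add: sum_distrib_right mult.assoc)
  qed
next
  case False
  \<comment> \<open>For negative \<open>\<beta>\<close> every summand grows at infinity, so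
    \<open>1 / G\<close> decays at least as fast as the reciprocal of any single one.\<close>
  obtain k where k: "k \<in> I" using I_nonempty by blast
  show ?thesis
  proof (rule that[of "31 / c k * exp (- \<beta> * R\<^sup>2)"])
    show "31 / c k * exp (- \<beta> * R\<^sup>2) \<ge> 0"
      using c_pos[OF k] by simp
    fix P :: "'i \<Rightarrow> 'a" and z :: 'a
    assume P: "\<And>i. i \<in> I \<Longrightarrow> norm (P i) \<le> R"
    have "G P z * (1 + G P z) * exp (- G P z) \<le> 31 / G P z"
      using mult_exp_neg_bounds(2) G_pos by blast
    also have "\<dots> \<le> 31 / g k (P k) z"
      using g_pos[OF k] g_le_G[OF k] G_pos by (intro divide_left_mono mult_pos_pos) auto
    also have "\<dots> = 31 / c k * exp (- (- \<beta> * (norm (z - P k))\<^sup>2))"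
      by (simp add: g_def exp_minus field_simps)
    also have "\<dots> \<le> 31 / c k * (exp (- \<beta> * R\<^sup>2) * exp (- (- \<beta> / 2 * (norm z)\<^sup>2)))"
      using False c_pos[OF k] P[OF k] by (intro mult_left_mono exp_gaussian_shift_le) auto
    finally show "G P z * (1 + G P z) * exp (- G P z)
        \<le> 31 / c k * exp (- \<beta> * R\<^sup>2) * exp (- (\<bar>\<beta>\<bar> / 2 * (norm z)\<^sup>2))"
      using False by (simp add: mult.assoc)
  qed
qed

text \<open>The extra linear factor bounds the inner products with velocities. The free
  \<open>s\<close> lets any quantity estimated in this form be bounded by \<open>D\<close>
  directly.\<close>

lemma dominating_function:
  fixes R V :: real
  assumes "V \<ge> 0"
  obtains D :: "'a::euclidean_space \<Rightarrow> real" where "integrable lborel D"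
    "\<And>P z s. (\<And>i. i \<in> I \<Longrightarrow> norm (P i) \<le> R)
       \<Longrightarrow> s \<le> G P z * (1 + G P z) * exp (- G P z) * ((norm z + R) * V) \<Longrightarrow> s \<le> D z"
proof -
  obtain K where K: "K \<ge> 0" "\<And>P z. (\<And>i. i \<in> I \<Longrightarrow> norm (P i :: 'a) \<le> R) \<Longrightarrow>
       G P z * (1 + G P z) * exp (- G P z) \<le> K * exp (- (\<bar>\<beta>\<bar> / 2 * (norm z)\<^sup>2))"
    using profile_bound by blast
  let ?D = "\<lambda>z::'a. K * V * (norm z * exp (- (\<bar>\<beta>\<bar> / 2 * (norm z)\<^sup>2)))
                     + K * V * R * exp (- (\<bar>\<beta>\<bar> / 2 * (norm z)\<^sup>2))"
  show ?thesis
  proof (rule that[of ?D])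
    show "integrable lborel ?D"
      using \<beta>_nonzero
      by (intro Bochner_Integration.integrable_add integrable_mult_right
            integrable_norm_gaussian integrable_gaussian) auto
    fix P :: "'i \<Rightarrow> 'a" and z :: 'a and s :: real
    assume P: "\<And>i. i \<in> I \<Longrightarrow> norm (P i) \<le> R"
      and s: "s \<le> G P z * (1 + G P z) * exp (- G P z) * ((norm z + R) * V)"
    obtain k where k: "k \<in> I" using I_nonempty by blast
    have "R \<ge> 0" using order_trans[OF norm_ge_zero P[OF k]] .
    note s
    also have "G P z * (1 + G P z) * exp (- G P z) * ((norm z + R) * V) \<le>
          K * exp (- (\<bar>\<beta>\<bar> / 2 * (norm z)\<^sup>2)) * ((norm z + R) * V)"
      using K(2)[OF P] \<open>R \<ge> 0\<close> assms by (intro mult_right_mono) auto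
    finally show "s \<le> ?D z" by (simp add: algebra_simps)
  qed
qed

lemma profile_integrable:
  fixes P :: "'i \<Rightarrow> 'a::euclidean_space"
  assumes [measurable]: "f \<in> borel_measurable borel"
    and le: "\<And>z. \<bar>f z\<bar> \<le> G P z * exp (- G P z)"
  shows "integrable lborel f"
proof -
  define R where "R = (\<Sum>i\<in>I. norm (P i))"
  have R: "norm (P i) \<le> R" if "i \<in> I" for i
    unfolding R_def using finite_I that by (intro member_le_sum) auto
  obtain K where K: "K \<ge> 0" "\<And>P z. (\<And>i. i \<in> I \<Longrightarrow> norm (P i :: 'a) \<le> R) \<Longrightarrow>
       G P z * (1 + G P z) * exp (- G P z) \<le> K * exp (- (\<bar>\<beta>\<bar> / 2 * (norm z)\<^sup>2))"
    using profile_bound by blast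
  show ?thesis
  proof (rule Bochner_Integration.integrable_bound)
    show "integrable lborel (\<lambda>z::'a. K * exp (- (\<bar>\<beta>\<bar> / 2 * (norm z)\<^sup>2)))"
      using \<beta>_nonzero by (intro integrable_mult_right integrable_gaussian) auto
    show "AE z in lborel. norm (f z) \<le> norm (K * exp (- (\<bar>\<beta>\<bar> / 2 * (norm z)\<^sup>2)))"
    proof (intro AE_I2)
      fix z :: 'a
      have "G P z * exp (- G P z) \<le> G P z * (1 + G P z) * exp (- G P z)"
        using G_pos[of P z] by (intro mult_right_mono) (auto simp: algebra_simps)
      thus "norm (f z) \<le> norm (K * exp (- (\<bar>\<beta>\<bar> / 2 * (norm z)\<^sup>2)))"
        using le[of z] K(2)[of P z, OF R] K(1) by simp
    qed
  qed simp
qed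

lemma abs_moment_le:
  fixes P v :: "'i \<Rightarrow> 'a::euclidean_space"
  assumes "\<And>i. i \<in> I \<Longrightarrow> norm (P i) \<le> R" "\<And>i. i \<in> I \<Longrightarrow> norm (v i) \<le> V"
  shows "\<bar>\<Sum>i\<in>I. g i (P i) z * ((z - P i) \<bullet> v i)\<bar> \<le> G P z * ((norm z + R) * V)"
proof -
  have "\<bar>\<Sum>i\<in>I. g i (P i) z * ((z - P i) \<bullet> v i)\<bar> \<le> (\<Sum>i\<in>I. \<bar>g i (P i) z * ((z - P i) \<bullet> v i)\<bar>)"
    by (rule sum_abs)
  also have "\<dots> \<le> (\<Sum>i\<in>I. g i (P i) z * ((norm z + R) * V))"
    using assms
    by (intro sum_mono) (auto simp: abs_mult g_nonneg intro!: mult_left_mono abs_inner_le)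
  finally show ?thesis by (simp add: G_def sum_distrib_right)
qed

section \<open>Divergence terms\<close>

text \<open>The derivative of \<open>exp (- G P z) * g i (P i) z\<close> with respect to \<open>z\<close> in the direction \<open>v\<close>.\<close>

definition transport :: "'i \<Rightarrow> ('i \<Rightarrow> 'a::euclidean_space) \<Rightarrow> 'a \<Rightarrow> 'a \<Rightarrow> real" where
  "transport i P v z = 2 * \<beta> * exp (- G P z) * g i (P i) z *
     ((\<Sum>j\<in>I. g j (P j) z * ((z - P j) \<bullet> v)) - (z - P i) \<bullet> v)"

lemma abs_transport_le:
  assumes i: "i \<in> I" and P: "\<And>i. i \<in> I \<Longrightarrow> norm (P i) \<le> R" and v: "norm v \<le> V"
  shows "\<bar>transport i P v z\<bar>
    \<le> G P z * (1 + G P z) * exp (- G P z) * ((norm z + R) * (2 * \<bar>\<beta>\<bar> * V))"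
proof -
  let ?s = "(\<Sum>j\<in>I. g j (P j) z * ((z - P j) \<bullet> v)) - (z - P i) \<bullet> v"
  have "\<bar>?s\<bar> \<le> G P z * ((norm z + R) * V) + (norm z + R) * V"
    using abs_moment_le[of P R "\<lambda>_. v" V z] abs_inner_le[OF P[OF i] v, of z] P v by fastforce
  also have "\<dots> = (1 + G P z) * ((norm z + R) * V)" by (simp add: algebra_simps)
  finally have "g i (P i) z * \<bar>?s\<bar> \<le> G P z * ((1 + G P z) * ((norm z + R) * V))"
    using g_pos[OF i] g_le_G[OF i] G_pos[of P z] by (intro mult_mono) (auto intro: less_imp_le)
  hence le: "2 * \<bar>\<beta>\<bar> * exp (- G P z) * (g i (P i) z * \<bar>?s\<bar>)
     \<le> 2 * \<bar>\<beta>\<bar> * exp (- G P z) * (G P z * ((1 + G P z) * ((norm z + R) * V)))"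
    by (intro mult_left_mono) auto
  have "\<bar>transport i P v z\<bar> = 2 * \<bar>\<beta>\<bar> * exp (- G P z) * (g i (P i) z * \<bar>?s\<bar>)"
    by (simp add: transport_def abs_mult g_nonneg[OF i])
  also note le
  finally show ?thesis by (simp only: mult_ac)
qed

text \<open>The integrand is the directional derivative of the integrable function
  \<open>exp (- G P z) * g i (P i) z\<close>, so translation invariance makes its integral
  vanish.\<close>

lemma integral_transport:
  fixes P :: "'i \<Rightarrow> 'a::euclidean_space"
  assumes i: "i \<in> I"
  shows "integrable lborel (transport i P v)" "(\<integral>z. transport i P v z \<partial>lborel) = 0"
proof -
  \<comment> \<open>The summand \<open>norm v\<close> keeps the shifted centres
    \<open>P i - t v\<close> in the ball of radius \<open>R\<close> for \<open>t\<close> in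
    \<open>[0, 1]\<close>.\<close>
  define R where "R = (\<Sum>i\<in>I. norm (P i)) + norm v"
  have R: "norm (P i) + norm v \<le> R" if "i \<in> I" for i
    unfolding R_def using finite_I that by (intro add_right_mono member_le_sum) auto
  obtain D :: "'a \<Rightarrow> real" where D: "integrable lborel D"
    "\<And>P z s. (\<And>i. i \<in> I \<Longrightarrow> norm (P i) \<le> R)
       \<Longrightarrow> s \<le> G P z * (1 + G P z) * exp (- G P z) * ((norm z + R) * (2 * \<bar>\<beta>\<bar> * norm v)) \<Longrightarrow> s \<le> D z"
    using dominating_function[of "2 * \<bar>\<beta>\<bar> * norm v" R] by auto
  have bound: "\<bar>transport i P v (z + t *\<^sub>R v)\<bar> \<le> D z" if "0 \<le> t" "t \<le> 1" for t z
  proof -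
    have t: "norm (t *\<^sub>R v) \<le> norm v" using that by (simp add: mult_left_le_one_le)
    have P: "norm (P i - t *\<^sub>R v) \<le> R" if "i \<in> I" for i
      using norm_triangle_ineq4[of "P i" "t *\<^sub>R v"] t R[OF that] by linarith
    have "transport i P v (z + t *\<^sub>R v) = transport i (\<lambda>i. P i - t *\<^sub>R v) v z"
      by (simp add: transport_def g_shift G_shift algebra_simps)
    thus ?thesis using D(2)[OF P abs_transport_le[OF i P order_refl]] by simp
  qed
  have cont: "continuous_on UNIV (transport i P v)"
    unfolding transport_def by (intro continuous_intros)
  show "integrable lborel (transport i P v)"
    using bound[of 0] order_trans[OF _ abs_ge_self] borel_measurable_continuous_onI[OF cont]
    by (intro Bochner_Integration.integrable_bound[OF D(1)]) auto
  \<comment> \<open>Translating the argument by \<open>t v\<close> amounts to moving all centres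
    with velocity \<open>- v\<close>.\<close>
  have G: "((\<lambda>t. G P (z + t *\<^sub>R v)) has_field_derivative
      2 * \<beta> * - (\<Sum>j\<in>I. g j (P j) (z + t *\<^sub>R v) * ((z + t *\<^sub>R v - P j) \<bullet> v))) (at t)" for z t
  proof -
    have "((\<lambda>t. P j - t *\<^sub>R v) has_vector_derivative - v) (at t)" for j
      by (auto intro!: derivative_eq_intros)
    from deriv_G[of "\<lambda>j t. P j - t *\<^sub>R v" "\<lambda>_. - v" t z, OF this] show ?thesis
      by (simp add: G_shift g_shift algebra_simps flip: sum_negf)
  qed
  have g: "((\<lambda>t. g i (P i) (z + t *\<^sub>R v)) has_field_derivative
      2 * \<beta> * - (g i (P i) (z + t *\<^sub>R v) * ((z + t *\<^sub>R v - P i) \<bullet> v))) (at t)" for z t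
  proof -
    have "((\<lambda>t. P i - t *\<^sub>R v) has_vector_derivative - v) (at t)"
      by (auto intro!: derivative_eq_intros)
    from deriv_g[OF this, of i z] show ?thesis
      by (simp add: g_shift algebra_simps)
  qed
  show "(\<integral>z. transport i P v z \<partial>lborel) = 0"
  proof (rule integral_directional_deriv_eq_0[OF _ cont bound D(1)])
    show "((\<lambda>t. exp (- G P (z + t *\<^sub>R v)) * g i (P i) (z + t *\<^sub>R v))
        has_field_derivative transport i P v (z + t *\<^sub>R v)) (at t)" for z t
      using g[of z t] G[of z t] unfolding transport_def
      by (auto intro!: derivative_eq_intros simp: algebra_simps)
    show "integrable lborel (\<lambda>z. exp (- G P z) * g i (P i) z)"
      by (intro profile_integrable[of _ P])
         (auto simp: abs_mult g_nonneg[OF i] g_le_G[OF i] mult.commute)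
  qed
qed

section \<open>The energy and its monotonicity along expansions\<close>

definition energy :: "('i \<Rightarrow> 'a::euclidean_space) \<Rightarrow> real" where
  "energy P = (\<integral>z. G P z * exp (- G P z) \<partial>lborel)"

lemma energy_integrable: "integrable lborel (\<lambda>z. G P z * exp (- G P z))"
  by (intro profile_integrable[of _ P]) (auto simp: G_nonneg)

text \<open>The rate of change of the integrand of \<^const>\<open>energy\<close> when the centres move with
  velocities \<open>v\<close>.\<close>

definition energy_rate :: "('i \<Rightarrow> 'a::euclidean_space) \<Rightarrow> ('i \<Rightarrow> 'a) \<Rightarrow> 'a \<Rightarrow> real" where
  "energy_rate P v z = 2 * \<beta> * exp (- G P z) * (1 - G P z) * (\<Sum>i\<in>I. g i (P i) z * ((z - P i) \<bullet> v i))"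

text \<open>The terms of first order in the \<open>g i\<close> cancel. The rest is a double sum of
  \<open>w i * w j * ((P i - P j) \<bullet> v i)\<close>; exchanging \<open>i\<close> and
  \<open>j\<close> and averaging produces the velocity difference.\<close>

lemma energy_rate_transport:
  "energy_rate P v z + (\<Sum>i\<in>I. transport i P (v i) z)
     = \<beta> * (exp (- G P z) * (\<Sum>i\<in>I. \<Sum>j\<in>I. g i (P i) z * g j (P j) z * ((P i - P j) \<bullet> (v i - v j))))"
proof -
  define w where "w i = g i (P i) z" for i
  define m where "m i j = (z - P j) \<bullet> v i" for i j
  have G: "G P z = sum w I" by (simp add: G_def w_def)
  have swap: "(\<Sum>i\<in>I. \<Sum>j\<in>I. w i * w j * h j i) = (\<Sum>i\<in>I. \<Sum>j\<in>I. w i * w j * h i j)" for h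
    by (subst sum.swap) (simp add: mult_ac)
  have "(\<Sum>i\<in>I. \<Sum>j\<in>I. w i * w j * ((P i - P j) \<bullet> (v i - v j)))
      = (\<Sum>i\<in>I. \<Sum>j\<in>I. w i * w j * (m i j - m i i)) + (\<Sum>i\<in>I. \<Sum>j\<in>I. w i * w j * (m j i - m j j))"
    unfolding sum.distrib[symmetric]
    by (intro sum.cong) (auto simp: m_def algebra_simps inner_diff_left inner_diff_right)
  also have "(\<Sum>i\<in>I. \<Sum>j\<in>I. w i * w j * (m j i - m j j)) = (\<Sum>i\<in>I. \<Sum>j\<in>I. w i * w j * (m i j - m i i))"
    by (rule swap)
  finally have 1: "(\<Sum>i\<in>I. \<Sum>j\<in>I. w i * w j * ((P i - P j) \<bullet> (v i - v j)))
      = 2 * (\<Sum>i\<in>I. \<Sum>j\<in>I. w i * w j * (m i j - m i i))" by simp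
  \<comment> \<open>The diagonal terms \<open>w i * m i i\<close> of the two parts cancel, which
    leaves only products of two weights.\<close>
  have 2: "(1 - sum w I) * (\<Sum>i\<in>I. w i * m i i) + (\<Sum>i\<in>I. w i * ((\<Sum>j\<in>I. w j * m i j) - m i i))
      = (\<Sum>i\<in>I. \<Sum>j\<in>I. w i * w j * (m i j - m i i))"
  proof -
    have "(\<Sum>j\<in>I. w i * w j * (m i j - m i i)) = w i * (\<Sum>j\<in>I. w j * m i j) - sum w I * (w i * m i i)" for i
      by (simp add: right_diff_distrib sum_subtractf sum_distrib_left sum_distrib_right mult_ac)
    thus ?thesis
      by (simp add: sum_subtractf right_diff_distrib left_diff_distrib flip: sum_distrib_left)
  qed
  have "energy_rate P v z + (\<Sum>i\<in>I. transport i P (v i) z) = 2 * \<beta> * exp (- G P z) *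
      ((1 - sum w I) * (\<Sum>i\<in>I. w i * m i i) + (\<Sum>i\<in>I. w i * ((\<Sum>j\<in>I. w j * m i j) - m i i)))"
    by (simp add: energy_rate_def transport_def G distrib_left sum_distrib_left mult.assoc
             flip: w_def m_def)
  thus ?thesis by (simp add: 2 1 flip: w_def)
qed

text \<open>The derivative of \<open>G * exp (- G)\<close> contributes a factor
  \<open>1 - G\<close>. Estimating it by \<open>1 + G\<close> leads to the profile
  \<open>G * (1 + G) * exp (- G)\<close>.\<close>

lemma energy_rate_bound:
  fixes R V :: real
  assumes "V \<ge> 0"
  obtains D :: "'a::euclidean_space \<Rightarrow> real" where "integrable lborel D"
    "\<And>P v z. (\<And>i. i \<in> I \<Longrightarrow> norm (P i) \<le> R) \<Longrightarrow> (\<And>i. i \<in> I \<Longrightarrow> norm (v i) \<le> V) \<Longrightarrow>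
       \<bar>energy_rate P v z\<bar> \<le> D z"
proof -
  obtain D :: "'a \<Rightarrow> real" where D: "integrable lborel D"
    "\<And>P z s. (\<And>i. i \<in> I \<Longrightarrow> norm (P i) \<le> R)
       \<Longrightarrow> s \<le> G P z * (1 + G P z) * exp (- G P z) * ((norm z + R) * (2 * \<bar>\<beta>\<bar> * V)) \<Longrightarrow> s \<le> D z"
    using dominating_function[of "2 * \<bar>\<beta>\<bar> * V" R] assms by auto
  show ?thesis
  proof (rule that[OF D(1)])
    fix P v :: "'i \<Rightarrow> 'a" and z :: 'a
    assume P: "\<And>i. i \<in> I \<Longrightarrow> norm (P i) \<le> R" and v: "\<And>i. i \<in> I \<Longrightarrow> norm (v i) \<le> V"
    have "\<bar>energy_rate P v z\<bar> = 2 * \<bar>\<beta>\<bar> * exp (- G P z) *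
        (\<bar>1 - G P z\<bar> * \<bar>\<Sum>i\<in>I. g i (P i) z * ((z - P i) \<bullet> v i)\<bar>)"
      by (simp add: energy_rate_def abs_mult)
    also have "\<dots> \<le> 2 * \<bar>\<beta>\<bar> * exp (- G P z) * ((1 + G P z) * (G P z * ((norm z + R) * V)))"
      using G_pos[of P z] by (intro mult_left_mono mult_mono abs_moment_le P v) auto
    finally show "\<bar>energy_rate P v z\<bar> \<le> D z"
      by (intro D(2)[OF P]) (simp_all only: mult_ac)
  qed
qed

text \<open>Adding the divergence terms \<^const>\<open>transport\<close>, whose integrals vanish, turns the integrand
  into a combination of the rates of change of the squared mutual distances with
  nonnegative coefficients.\<close>

lemma integral_energy_rate_nonneg:
  fixes P v :: "'i \<Rightarrow> 'a::euclidean_space"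
  assumes expand: "\<And>i j. i \<in> I \<Longrightarrow> j \<in> I \<Longrightarrow> (P i - P j) \<bullet> (v i - v j) \<ge> 0"
  shows "\<beta> * (\<integral>z. energy_rate P v z \<partial>lborel) \<ge> 0"
proof -
  define R where "R = (\<Sum>i\<in>I. norm (P i))"
  define V where "V = (\<Sum>i\<in>I. norm (v i))"
  have R: "norm (P i) \<le> R" if "i \<in> I" for i
    unfolding R_def using finite_I that by (intro member_le_sum) auto
  have V: "norm (v i) \<le> V" if "i \<in> I" for i
    unfolding V_def using finite_I that by (intro member_le_sum) auto
  obtain D :: "'a \<Rightarrow> real" where D: "integrable lborel D"
    "\<And>P v z. (\<And>i. i \<in> I \<Longrightarrow> norm (P i) \<le> R) \<Longrightarrow> (\<And>i. i \<in> I \<Longrightarrow> norm (v i) \<le> V) \<Longrightarrow>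
       \<bar>energy_rate P v z\<bar> \<le> D z"
    using energy_rate_bound[of V R] by (auto simp: V_def sum_nonneg)
  have meas: "energy_rate P v \<in> borel_measurable borel"
    unfolding energy_rate_def by (intro borel_measurable_continuous_onI continuous_intros)
  have int: "integrable lborel (energy_rate P v)"
    using meas order_trans[OF D(2)[of P v, OF R V] abs_ge_self]
    by (intro Bochner_Integration.integrable_bound[OF D(1)]) auto
  have "(\<integral>z. energy_rate P v z \<partial>lborel)
      = (\<integral>z. energy_rate P v z \<partial>lborel) + (\<Sum>i\<in>I. \<integral>z. transport i P (v i) z \<partial>lborel)"
    by (simp add: integral_transport)
  also have "\<dots> = (\<integral>z. energy_rate P v z + (\<Sum>i\<in>I. transport i P (v i) z) \<partial>lborel)"
    using int by (simp add: integral_transport)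
  also have "\<dots> = \<beta> * (\<integral>z. exp (- G P z) *
      (\<Sum>i\<in>I. \<Sum>j\<in>I. g i (P i) z * g j (P j) z * ((P i - P j) \<bullet> (v i - v j))) \<partial>lborel)"
    by (simp only: energy_rate_transport) simp
  \<comment> \<open>The additional factor \<open>\<beta>\<close> completes a square, which makes the
    sign of the result independent of that of \<open>\<beta>\<close>.\<close>
  finally have "\<beta> * (\<integral>z. energy_rate P v z \<partial>lborel) = \<beta>\<^sup>2 * (\<integral>z. exp (- G P z) *
      (\<Sum>i\<in>I. \<Sum>j\<in>I. g i (P i) z * g j (P j) z * ((P i - P j) \<bullet> (v i - v j))) \<partial>lborel)"
    by (simp add: power2_eq_square)
  also have "\<dots> \<ge> 0"
    by (intro mult_nonneg_nonneg Bochner_Integration.integral_nonneg sum_nonneg g_nonneg expand) auto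
  finally show ?thesis .
qed

text \<open>The rate has the sign of \<open>\<beta>\<close> at each time in \<open>[a, b]\<close>;
  integrating over time gives growth for \<open>\<beta> > 0\<close> and decay for
  \<open>\<beta> < 0\<close>, both expressed by the factor \<open>\<beta>\<close>.\<close>

lemma energy_mono:
  fixes P P' :: "'i \<Rightarrow> real \<Rightarrow> 'a::euclidean_space"
  assumes ab: "a \<le> b"
    and deriv: "\<And>i t. i \<in> I \<Longrightarrow> (P i has_vector_derivative P' i t) (at t)"
    and cont: "\<And>i. i \<in> I \<Longrightarrow> continuous_on UNIV (P' i)"
    and bounds: "\<And>i t. i \<in> I \<Longrightarrow> norm (P i t) \<le> R" "\<And>i t. i \<in> I \<Longrightarrow> norm (P' i t) \<le> V"
    and expand: "\<And>i j t. i \<in> I \<Longrightarrow> j \<in> I \<Longrightarrow> a \<le> t \<Longrightarrow> t \<le> b \<Longrightarrow>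
        (P i t - P j t) \<bullet> (P' i t - P' j t) \<ge> 0"
  shows "\<beta> * energy (\<lambda>i. P i a) \<le> \<beta> * energy (\<lambda>i. P i b)"
proof -
  let ?r = "\<lambda>t. energy_rate (\<lambda>i. P i t) (\<lambda>i. P' i t)"
  obtain k where k: "k \<in> I" using I_nonempty by blast
  have "V \<ge> 0" using order_trans[OF norm_ge_zero bounds(2)[OF k]] .
  then obtain D :: "'a \<Rightarrow> real" where D: "integrable lborel D"
    "\<And>P v z. (\<And>i. i \<in> I \<Longrightarrow> norm (P i) \<le> R) \<Longrightarrow> (\<And>i. i \<in> I \<Longrightarrow> norm (v i) \<le> V) \<Longrightarrow>
       \<bar>energy_rate P v z\<bar> \<le> D z"
    using energy_rate_bound[of V R] by auto
  have contP: "continuous_on UNIV (P i)" if "i \<in> I" for i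
    using deriv[OF that] by (intro continuous_at_imp_continuous_on ballI has_vector_derivative_continuous)
  have d: "((\<lambda>t. G (\<lambda>i. P i t) z * exp (- G (\<lambda>i. P i t) z)) has_field_derivative ?r t z) (at t)" for t z
    using deriv_G[of P "\<lambda>i. P' i t" t z, OF deriv] unfolding energy_rate_def
    by (auto intro!: derivative_eq_intros simp: algebra_simps)
  have c: "continuous_on UNIV (\<lambda>(t, z). ?r t z)"
    unfolding energy_rate_def case_prod_beta
    by (intro continuous_intros continuous_on_compose2[OF contP] continuous_on_compose2[OF cont]) auto
  have "energy (\<lambda>i. P i b) - energy (\<lambda>i. P i a) = (\<integral>t. indicator {a..b} t * (\<integral>z. ?r t z \<partial>lborel) \<partial>lborel)"
    unfolding energy_def
    by (rule integral_diff_eq_integral_deriv[OF ab d c D(2) D(1) energy_integrable energy_integrable])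
       (auto intro: bounds)
  hence "\<beta> * (energy (\<lambda>i. P i b) - energy (\<lambda>i. P i a))
      = (\<integral>t. indicator {a..b} t * (\<beta> * (\<integral>z. ?r t z \<partial>lborel)) \<partial>lborel)"
    by (simp add: mult.left_commute[of "indicator {a..b} t" \<beta> for t])
  also have "\<dots> \<ge> 0"
    by (intro Bochner_Integration.integral_nonneg) (auto split: split_indicator intro!: integral_energy_rate_nonneg expand)
  finally show ?thesis by (simp add: right_diff_distrib)
qed

section \<open>Reduction from four dimensions to the plane\<close>

text \<open>What remains, up to \<open>pi / \<beta>\<close>, after integrating out two dimensions.
  With \<open>a\<close> a steep mixture it approximates the indicator of the union for
  \<open>\<beta> > 0\<close> and minus that of the intersection for
  \<open>\<beta> < 0\<close>.\<close>

definition \<phi> :: "real \<Rightarrow> real" where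
  "\<phi> a = (if \<beta> > 0 then 1 - exp (- a) else - exp (- a))"

lemma integral_profile_plane:
  assumes dim: "DIM('b::euclidean_space) = 2" and a: "a > 0"
  defines "f \<equiv> \<lambda>u. a * exp (- (\<beta> * u)) * exp (- (a * exp (- (\<beta> * u))))"
  shows "(\<integral>y. f ((norm (y::'b))\<^sup>2) \<partial>lborel) = pi / \<beta> * \<phi> a"
proof -
  \<comment> \<open>In the variable \<open>u = (norm y)\<^sup>2\<close> the profile is an exact
    derivative: \<open>F\<close> is its antiderivative and \<open>T\<close> the limit of
    \<open>F\<close> at infinity. The sign of \<open>\<beta>\<close> decides \<open>T\<close>,
    whence the cases in \<open>\<phi>\<close>.\<close>
  define F where "F = (\<lambda>u. exp (- (a * exp (- (\<beta> * u)))) / \<beta>)"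
  define T where "T = (if \<beta> > 0 then 1 / \<beta> else 0)"
  have [measurable]: "f \<in> borel_measurable borel"
    unfolding f_def by measurable
  have f_nonneg: "f u \<ge> 0" for u using a by (simp add: f_def)
  have T: "(F \<longlongrightarrow> T) at_top"
  proof (cases "\<beta> > 0")
    case True
    hence "filterlim (\<lambda>u. \<beta> * u) at_top at_top"
      by (intro filterlim_tendsto_pos_mult_at_top[OF tendsto_const] filterlim_ident)
    hence "filterlim (\<lambda>u. - (\<beta> * u)) at_bot at_top"
      by (simp add: filterlim_uminus_at_bot)
    hence "((\<lambda>u. exp (- (\<beta> * u))) \<longlongrightarrow> 0) at_top"
      by (rule filterlim_compose[OF exp_at_bot])
    hence "(F \<longlongrightarrow> exp (- (a * 0)) / \<beta>) at_top"
      unfolding F_def by (intro tendsto_intros) (use True in auto)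
    thus ?thesis using True by (simp add: T_def)
  next
    case False
    hence "filterlim (\<lambda>u. - \<beta> * u) at_top at_top" using \<beta>_nonzero
      by (intro filterlim_tendsto_pos_mult_at_top[OF tendsto_const] filterlim_ident) auto
    hence "filterlim (\<lambda>u. exp (- (\<beta> * u))) at_top at_top"
      by (intro filterlim_compose[OF exp_at_top]) simp
    hence "filterlim (\<lambda>u. a * exp (- (\<beta> * u))) at_top at_top" using a
      by (intro filterlim_tendsto_pos_mult_at_top[OF tendsto_const])
    hence "filterlim (\<lambda>u. - (a * exp (- (\<beta> * u)))) at_bot at_top"
      by (simp add: filterlim_uminus_at_bot)
    hence "((\<lambda>u. exp (- (a * exp (- (\<beta> * u))))) \<longlongrightarrow> 0) at_top"
      by (rule filterlim_compose[OF exp_at_bot])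
    thus ?thesis using False tendsto_divide_zero by (auto simp: T_def F_def)
  qed
  have "(\<integral>\<^sup>+u. ennreal (f u) * indicator {0..} u \<partial>lborel) = ennreal (T - F 0)"
  proof (rule nn_integral_FTC_atLeast)
    show "(F has_real_derivative f u) (at u)" for u
      unfolding F_def f_def using \<beta>_nonzero
      by (auto intro!: derivative_eq_intros simp: field_simps)
  qed (use f_nonneg T in auto)
  also have "T - F 0 = \<phi> a / \<beta>"
    by (simp add: T_def F_def \<phi>_def diff_divide_distrib)
  finally have "(\<integral>\<^sup>+y. ennreal (f ((norm (y::'b))\<^sup>2)) \<partial>lborel) = ennreal pi * ennreal (\<phi> a / \<beta>)"
    by (subst nn_integral_norm_sq_plane[OF dim, of "\<lambda>u. ennreal (f u)"]) auto
  also have "\<dots> = ennreal (pi / \<beta> * \<phi> a)"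
    by (simp flip: ennreal_mult')
  finally have "(\<integral>\<^sup>+y. ennreal (f ((norm (y::'b))\<^sup>2)) \<partial>lborel) = ennreal (pi / \<beta> * \<phi> a)" .
  moreover have "pi / \<beta> * \<phi> a \<ge> 0"
    using a \<beta>_nonzero by (auto simp: \<phi>_def divide_nonneg_neg)
  ultimately show ?thesis
    by (intro has_bochner_integral_integral_eq has_bochner_integral_nn_integral)
       (auto simp: f_nonneg)
qed

text \<open>Centres with second component 0 make the mixture split as \<open>G p x\<close> times a
  centred Gaussian in \<open>y\<close>, so Fubini reduces the inner integral to the plane profile
  with \<open>a = G p x\<close>.\<close>

lemma energy_fst:
  fixes p :: "'i \<Rightarrow> 'a::euclidean_space"
  assumes dim: "DIM('b::euclidean_space) = 2"
  shows "energy (\<lambda>i. (p i, 0::'b)) = pi / \<beta> * (\<integral>x. \<phi> (G p x) \<partial>lborel)"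
proof -
  have "G (\<lambda>i. (p i, 0)) (x, y) = G p x * exp (- (\<beta> * (norm y)\<^sup>2))" for x and y :: 'b
    by (simp add: G_def g_def norm_Pair sum_distrib_right ring_distribs mult.assoc flip: exp_add)
  hence "energy (\<lambda>i. (p i, 0::'b)) = (\<integral>x. (\<integral>y. G p x * exp (- (\<beta> * (norm (y::'b))\<^sup>2)) *
      exp (- (G p x * exp (- (\<beta> * (norm y)\<^sup>2)))) \<partial>lborel) \<partial>lborel)"
    using lborel_pair.integral_fst'[of "\<lambda>z. G (\<lambda>i. (p i, 0::'b)) z * exp (- G (\<lambda>i. (p i, 0)) z)"]
    by (simp add: energy_def lborel_prod energy_integrable)
  also have "\<dots> = (\<integral>x. pi / \<beta> * \<phi> (G p x) \<partial>lborel)"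
    by (simp only: integral_profile_plane[OF dim G_pos])
  finally show ?thesis by simp
qed

lemma energy_snd:
  fixes q :: "'i \<Rightarrow> 'b::euclidean_space"
  assumes dim: "DIM('a::euclidean_space) = 2"
  shows "energy (\<lambda>i. (0::'a, q i)) = pi / \<beta> * (\<integral>y. \<phi> (G q y) \<partial>lborel)"
proof -
  have "G (\<lambda>i. (0, q i)) (x, y) = G q y * exp (- (\<beta> * (norm x)\<^sup>2))" for y and x :: 'a
    by (simp add: G_def g_def norm_Pair sum_distrib_right ring_distribs mult.assoc add.commute
          flip: exp_add)
  note G = this
  \<comment> \<open>Here Fubini is applied in the other order, since the first component is
    integrated out.\<close>
  have int: "integrable (lborel \<Otimes>\<^sub>M lborel) (\<lambda>(x, y). G (\<lambda>i. (0::'a, q i)) (x, y)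
      * exp (- G (\<lambda>i. (0, q i)) (x, y)))"
    using energy_integrable[of "\<lambda>i. (0::'a, q i)"] by (simp add: lborel_prod case_prod_beta')
  have "energy (\<lambda>i. (0::'a, q i)) = (\<integral>y. (\<integral>x. G q y * exp (- (\<beta> * (norm (x::'a))\<^sup>2)) *
      exp (- (G q y * exp (- (\<beta> * (norm x)\<^sup>2)))) \<partial>lborel) \<partial>lborel)"
    using lborel_pair.integral_snd[OF int]
    by (simp only: G) (simp add: energy_def lborel_prod case_prod_beta' flip: G)
  also have "\<dots> = (\<integral>y. pi / \<beta> * \<phi> (G q y) \<partial>lborel)"
    by (simp only: integral_profile_plane[OF dim G_pos])
  finally show ?thesis by simp
qed

text \<open>Along the path the squared mutual distances are \<open>(cos t)\<^sup>2 * (norm (p i - p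
  j))\<^sup>2 + (sin t)\<^sup>2 * (norm (q i - q j))\<^sup>2\<close>, which increase on
  \<open>[0, pi / 2]\<close>.\<close>

lemma integral_mono_expansion:
  fixes p q :: "'i \<Rightarrow> 'a::euclidean_space"
  assumes dim: "DIM('a) = 2"
    and expansion: "\<And>i j. i \<in> I \<Longrightarrow> j \<in> I \<Longrightarrow> norm (p i - p j) \<le> norm (q i - q j)"
  shows "(\<integral>x. \<phi> (G p x) \<partial>lborel) \<le> (\<integral>x. \<phi> (G q x) \<partial>lborel)"
proof -
  define P where "P i t = (cos t *\<^sub>R p i, sin t *\<^sub>R q i)" for i t
  define P' where "P' i t = (- sin t *\<^sub>R p i, cos t *\<^sub>R q i)" for i t
  define R where "R = (\<Sum>i\<in>I. norm (p i) + norm (q i))"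
  have R: "norm (p i) + norm (q i) \<le> R" if "i \<in> I" for i
    unfolding R_def using finite_I that by (intro member_le_sum) auto
  have pair: "norm (x *\<^sub>R u, y *\<^sub>R w) \<le> norm u + norm w" if "\<bar>x\<bar> \<le> 1" "\<bar>y\<bar> \<le> 1" for x y and u w :: 'a
  proof -
    have "norm (x *\<^sub>R u, y *\<^sub>R w) \<le> norm (x *\<^sub>R u) + norm (y *\<^sub>R w)"
      using sqrt_sum_squares_le_sum by (simp add: norm_Pair)
    also have "\<dots> \<le> norm u + norm w"
      using that by (intro add_mono) (auto simp: mult_left_le_one_le)
    finally show ?thesis .
  qed
  have "\<beta> * energy (\<lambda>i. P i 0) \<le> \<beta> * energy (\<lambda>i. P i (pi / 2))"
  proof (rule energy_mono[where P' = P' and R = R and V = R])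
    show "(P i has_vector_derivative P' i t) (at t)" for i t
      unfolding P_def P'_def by (auto intro!: derivative_eq_intros)
    show "continuous_on UNIV (P' i)" for i
      unfolding P'_def by (intro continuous_intros)
    show "norm (P i t) \<le> R" "norm (P' i t) \<le> R" if "i \<in> I" for i t
      unfolding P_def P'_def using R[OF that]
      by (rule order_trans[OF pair, rotated 2]; simp)+
    show "(P i t - P j t) \<bullet> (P' i t - P' j t) \<ge> 0" if "i \<in> I" "j \<in> I" "0 \<le> t" "t \<le> pi / 2" for i j t
    proof -
      have "(P i t - P j t) \<bullet> (P' i t - P' j t)
          = sin t * cos t * ((norm (q i - q j))\<^sup>2 - (norm (p i - p j))\<^sup>2)"
        by (simp add: P_def P'_def power2_norm_eq_inner inner_commute algebra_simps)
      moreover have "sin t \<ge> 0" "cos t \<ge> 0"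
        using that by (auto intro!: sin_ge_zero cos_ge_zero)
      moreover have "(norm (p i - p j))\<^sup>2 \<le> (norm (q i - q j))\<^sup>2"
        using expansion[OF that(1,2)] by (intro power_mono) auto
      ultimately show ?thesis by simp
    qed
  qed simp
  \<comment> \<open>At both ends \<open>\<beta> * energy\<close> is \<open>pi\<close> times the
    integral of \<open>\<phi>\<close>, so the sign of \<open>\<beta>\<close> drops out.\<close>
  thus ?thesis
    using \<beta>_nonzero by (simp add: P_def energy_fst[OF dim] energy_snd[OF dim])
qed

end

section \<open>The limit of steep Gaussians\<close>

text \<open>The steepness runs through \<open>Suc n\<close> rather than \<open>n\<close>:
  \<open>\<beta>\<close> must be nonzero, and the majorant for unions uses that it is at least
  1.\<close>

lemma tendsto_exp_mult_seq:
  fixes a :: real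
  shows "a < 0 \<Longrightarrow> (\<lambda>n. exp (real (Suc n) * a)) \<longlonglongrightarrow> 0"
    and "a > 0 \<Longrightarrow> filterlim (\<lambda>n. exp (real (Suc n) * a)) at_top sequentially"
proof -
  have *: "filterlim (\<lambda>n. real (Suc n)) at_top sequentially"
    using filterlim_Suc filterlim_real_sequentially by (rule filterlim_compose[rotated])
  show "(\<lambda>n. exp (real (Suc n) * a)) \<longlonglongrightarrow> 0" if "a < 0"
    using filterlim_tendsto_neg_mult_at_bot[OF tendsto_const that *]
    by (intro filterlim_compose[OF exp_at_bot]) (simp only: mult.commute)
  show "filterlim (\<lambda>n. exp (real (Suc n) * a)) at_top sequentially" if "a > 0"
    using filterlim_tendsto_pos_mult_at_top[OF tendsto_const that *]
    by (intro filterlim_compose[OF exp_at_top]) (simp only: mult.commute)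
qed

lemma tendsto_sum_exp_mult:
  fixes e :: "'i \<Rightarrow> real"
  assumes "finite I"
  shows "(\<And>i. i \<in> I \<Longrightarrow> e i < 0) \<Longrightarrow> (\<lambda>n. \<Sum>i\<in>I. exp (real (Suc n) * e i)) \<longlonglongrightarrow> 0"
    and "i \<in> I \<Longrightarrow> e i > 0 \<Longrightarrow> filterlim (\<lambda>n. \<Sum>i\<in>I. exp (real (Suc n) * e i)) at_top sequentially"
proof -
  assume "\<And>i. i \<in> I \<Longrightarrow> e i < 0"
  hence "(\<lambda>n. \<Sum>i\<in>I. exp (real (Suc n) * e i)) \<longlonglongrightarrow> (\<Sum>i\<in>I. 0)"
    by (intro tendsto_sum tendsto_exp_mult_seq)
  thus "(\<lambda>n. \<Sum>i\<in>I. exp (real (Suc n) * e i)) \<longlonglongrightarrow> 0" by simp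
next
  assume i: "i \<in> I" "e i > 0"
  show "filterlim (\<lambda>n. \<Sum>i\<in>I. exp (real (Suc n) * e i)) at_top sequentially"
    using assms i by (intro filterlim_at_top_mono[OF tendsto_exp_mult_seq(2)[OF i(2)]])
      (auto intro!: always_eventually member_le_sum)
qed

lemma tendsto_exp_neg_at_top:
  "filterlim f at_top F \<Longrightarrow> ((\<lambda>x. exp (- f x :: real)) \<longlongrightarrow> 0) F"
  by (rule filterlim_compose[OF exp_at_bot]) (simp add: filterlim_uminus_at_bot)

text \<open>On a bounding sphere a summand of the mixture stays equal to 1, so the limit may miss
  the value of the indicator; this null set is discarded.\<close>

lemma AE_lborel_notin_spheres:
  fixes p :: "'i \<Rightarrow> 'a::euclidean_space"
  assumes "finite I"
  shows "AE x in lborel. \<forall>i\<in>I. norm (x - p i) \<noteq> r i"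
proof (rule AE_finite_allI[OF assms])
  fix i
  have "sphere (p i) (r i) \<in> null_sets lborel"
    using negligible_sphere[of "p i" "r i"]
    by (simp add: negligible_iff_null_sets null_sets_completion_iff)
  from AE_not_in[OF this] show "AE x in lborel. norm (x - p i) \<noteq> r i"
    by eventually_elim (simp add: dist_norm norm_minus_commute)
qed

lemma square_less_square_iff:
  fixes a b :: real
  shows "a \<ge> 0 \<Longrightarrow> b \<ge> 0 \<Longrightarrow> a\<^sup>2 < b\<^sup>2 \<longleftrightarrow> a < b"
  by (meson power2_less_imp_less power_strict_mono zero_less_numeral)

lemma integral_tendsto_measure_UN:
  fixes p :: "'i \<Rightarrow> 'a::euclidean_space"
  assumes I: "finite I" and r: "\<And>i. i \<in> I \<Longrightarrow> r i \<ge> 0"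
  shows "(\<lambda>n. \<integral>x. 1 - exp (- (\<Sum>i\<in>I. exp (real (Suc n) * ((r i)\<^sup>2 - (norm (x - p i))\<^sup>2)))) \<partial>lborel)
           \<longlonglongrightarrow> measure lborel (\<Union>i\<in>I. cball (p i) (r i))" (is "?f \<longlonglongrightarrow> measure lborel ?U")
proof -
  define e where "e x i = (r i)\<^sup>2 - (norm (x - p i))\<^sup>2" for x i
  have e: "e x i > 0 \<longleftrightarrow> norm (x - p i) < r i" "e x i < 0 \<longleftrightarrow> norm (x - p i) > r i" if "i \<in> I" for x i
    using r[OF that] by (simp_all add: e_def square_less_square_iff)
  \<comment> \<open>The majorant is the mixture at \<open>n = 0\<close>.\<close>
  let ?h = "\<lambda>x. \<Sum>i\<in>I. exp ((r i)\<^sup>2) * exp (- (1 * (norm (x - p i))\<^sup>2))"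
  have h: "?h x = (\<Sum>i\<in>I. exp (e x i))" for x
    by (simp add: e_def flip: exp_add)
  have "(\<lambda>n. \<integral>x. 1 - exp (- (\<Sum>i\<in>I. exp (real (Suc n) * e x i))) \<partial>lborel)
      \<longlonglongrightarrow> (\<integral>x. indicator ?U x \<partial>lborel)"
  proof (rule integral_dominated_convergence)
    show "integrable lborel ?h"
      by (intro Bochner_Integration.integrable_sum integrable_mult_right integrable_gaussian_shift) auto
    show "AE x in lborel. (\<lambda>n. 1 - exp (- (\<Sum>i\<in>I. exp (real (Suc n) * e x i)))) \<longlonglongrightarrow> indicator ?U x"
      using AE_lborel_notin_spheres[OF I, of p r]
    proof eventually_elim
      case (elim x)
      show ?case
      proof (cases "x \<in> ?U")
        case True
        then obtain i where i: "i \<in> I" "norm (x - p i) < r i"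
          using elim by (force simp: dist_norm norm_minus_commute)
        hence "filterlim (\<lambda>n. \<Sum>i\<in>I. exp (real (Suc n) * e x i)) at_top sequentially"
          by (intro tendsto_sum_exp_mult(2)[OF I]) (auto simp: e)
        from tendsto_diff[OF tendsto_const tendsto_exp_neg_at_top[OF this], of 1]
        show ?thesis using True by simp
      next
        case False
        hence "(\<lambda>n. \<Sum>i\<in>I. exp (real (Suc n) * e x i)) \<longlonglongrightarrow> 0"
          by (intro tendsto_sum_exp_mult(1)[OF I]) (auto simp: e dist_norm norm_minus_commute not_le)
        hence "(\<lambda>n. 1 - exp (- (\<Sum>i\<in>I. exp (real (Suc n) * e x i)))) \<longlonglongrightarrow> 1 - exp (- 0)"
          by (intro tendsto_intros)
        thus ?thesis using False by simp
      qed
    qed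
    show "AE x in lborel. norm (1 - exp (- (\<Sum>i\<in>I. exp (real (Suc n) * e x i)))) \<le> ?h x" for n
    proof (intro AE_I2)
      fix x
      define s where "s = (\<Sum>i\<in>I. exp (real (Suc n) * e x i))"
      have s: "s \<ge> 0" unfolding s_def by (intro sum_nonneg) auto
      \<comment> \<open>If some exponent is positive, the majorant already exceeds 1. Otherwise all
        exponents are at most 0, and increasing the steepness only lowers the summands.\<close>
      have "1 - exp (- s) \<le> ?h x"
      proof (cases "\<exists>i\<in>I. e x i > 0")
        case True
        then obtain i where i: "i \<in> I" "e x i > 0" by blast
        have "1 - exp (- s) \<le> exp (e x i)" using i one_le_exp_iff[of "e x i"] by (smt (verit) exp_gt_zero)
        also have "\<dots> \<le> ?h x" unfolding h using i I by (intro member_le_sum) auto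
        finally show ?thesis .
      next
        case False
        have "1 - exp (- s) \<le> s" using exp_ge_add_one_self[of "- s"] by simp
        also have "\<dots> \<le> ?h x" unfolding h s_def
          using False by (intro sum_mono) (auto simp: not_less algebra_simps mult_nonneg_nonpos)
        finally show ?thesis .
      qed
      thus "norm (1 - exp (- (\<Sum>i\<in>I. exp (real (Suc n) * e x i)))) \<le> ?h x"
        using s unfolding s_def[symmetric] by simp
    qed
  qed (auto simp: e_def I intro!: borel_measurable_indicator borel_closed closed_UN)
  thus ?thesis
    by (simp add: e_def)
qed

lemma integral_tendsto_measure_INT:
  fixes p :: "'i \<Rightarrow> 'a::euclidean_space"
  assumes I: "finite I" "I \<noteq> {}" and r: "\<And>i. i \<in> I \<Longrightarrow> r i \<ge> 0"
  shows "(\<lambda>n. \<integral>x. exp (- (\<Sum>i\<in>I. exp (real (Suc n) * ((norm (x - p i))\<^sup>2 - (r i)\<^sup>2)))) \<partial>lborel)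
           \<longlonglongrightarrow> measure lborel (\<Inter>i\<in>I. cball (p i) (r i))" (is "?f \<longlonglongrightarrow> measure lborel ?U")
proof -
  define e where "e x i = (norm (x - p i))\<^sup>2 - (r i)\<^sup>2" for x i
  have e: "e x i > 0 \<longleftrightarrow> norm (x - p i) > r i" "e x i < 0 \<longleftrightarrow> norm (x - p i) < r i" if "i \<in> I" for x i
    using r[OF that] by (simp_all add: e_def square_less_square_iff)
  \<comment> \<open>A single disk suffices for the majorant, since the intersection lies inside
    it.\<close>
  obtain k where k: "k \<in> I" using I by blast
  let ?h = "\<lambda>x. exp ((r k)\<^sup>2) * exp (- (1 * (norm (x - p k))\<^sup>2))"
  have h: "?h x = exp (- e x k)" for x
    by (simp add: e_def flip: exp_add)
  have "(\<lambda>n. \<integral>x. exp (- (\<Sum>i\<in>I. exp (real (Suc n) * e x i))) \<partial>lborel)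
      \<longlonglongrightarrow> (\<integral>x. indicator ?U x \<partial>lborel)"
  proof (rule integral_dominated_convergence)
    show "integrable lborel ?h"
      by (intro integrable_mult_right integrable_gaussian_shift) auto
    show "AE x in lborel. (\<lambda>n. exp (- (\<Sum>i\<in>I. exp (real (Suc n) * e x i)))) \<longlonglongrightarrow> indicator ?U x"
      using AE_lborel_notin_spheres[OF I(1), of p r]
    proof eventually_elim
      case (elim x)
      show ?case
      proof (cases "x \<in> ?U")
        case True
        hence "norm (x - p i) < r i" if "i \<in> I" for i
          using elim that by (force simp: dist_norm norm_minus_commute)
        hence "(\<lambda>n. \<Sum>i\<in>I. exp (real (Suc n) * e x i)) \<longlonglongrightarrow> 0"
          by (intro tendsto_sum_exp_mult(1)[OF I(1)]) (auto simp: e)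
        hence "(\<lambda>n. exp (- (\<Sum>i\<in>I. exp (real (Suc n) * e x i)))) \<longlonglongrightarrow> exp (- 0)"
          by (intro tendsto_intros)
        thus ?thesis using True by simp
      next
        case False
        then obtain i where i: "i \<in> I" "norm (x - p i) > r i"
          by (force simp: dist_norm norm_minus_commute)
        hence "filterlim (\<lambda>n. \<Sum>i\<in>I. exp (real (Suc n) * e x i)) at_top sequentially"
          by (intro tendsto_sum_exp_mult(2)[OF I(1)]) (auto simp: e)
        from tendsto_exp_neg_at_top[OF this] show ?thesis using False by simp
      qed
    qed
    show "AE x in lborel. norm (exp (- (\<Sum>i\<in>I. exp (real (Suc n) * e x i)))) \<le> ?h x" for n
    proof (intro AE_I2)
      fix x
      \<comment> \<open>For a nonnegative exponent this is \<open>u < exp u\<close> together with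
        \<open>Suc n \<ge> 1\<close>; for a negative one the right side is positive.\<close>
      have "e x k \<le> exp (real (Suc n) * e x k)"
      proof (cases "e x k \<ge> 0")
        case True
        have "e x k \<le> real (Suc n) * e x k" using True by (simp add: algebra_simps)
        also have "\<dots> \<le> exp (real (Suc n) * e x k)" by (rule less_imp_le[OF exp_gt_self])
        finally show ?thesis .
      qed (smt (verit) exp_gt_zero)
      also have "\<dots> \<le> (\<Sum>i\<in>I. exp (real (Suc n) * e x i))"
        using k I(1) by (intro member_le_sum) auto
      finally show "norm (exp (- (\<Sum>i\<in>I. exp (real (Suc n) * e x i)))) \<le> ?h x"
        unfolding h by simp
    qed
  qed (auto simp: e_def I intro!: borel_measurable_indicator borel_closed closed_INT)
  thus ?thesis
    by (simp add: e_def)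
qed

section \<open>Passage from mixtures to disks\<close>

lemma kneser_poulsen_plane:
  fixes p q :: "'i \<Rightarrow> 'a::euclidean_space"
  assumes dim: "DIM('a) = 2" and I: "finite I" "I \<noteq> {}" and r: "\<And>i. i \<in> I \<Longrightarrow> r i \<ge> 0"
    and expansion: "\<And>i j. i \<in> I \<Longrightarrow> j \<in> I \<Longrightarrow> norm (p i - p j) \<le> norm (q i - q j)"
  shows "measure lborel (\<Union>i\<in>I. cball (p i) (r i)) \<le> measure lborel (\<Union>i\<in>I. cball (q i) (r i))"
    and "measure lborel (\<Inter>i\<in>I. cball (p i) (r i)) \<ge> measure lborel (\<Inter>i\<in>I. cball (q i) (r i))"
proof -
  show "measure lborel (\<Union>i\<in>I. cball (p i) (r i)) \<le> measure lborel (\<Union>i\<in>I. cball (q i) (r i))"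
  proof (rule LIMSEQ_le[OF integral_tendsto_measure_UN[OF I(1) r] integral_tendsto_measure_UN[OF I(1) r]],
         goal_cases)
    \<comment> \<open>The first two goals are index memberships left by \<open>r\<close>; the third
      is the comparison for each \<open>n\<close>.\<close>
    case 3
    show ?case
    proof (intro exI[of _ 0] allI impI)
      fix n :: nat
      interpret gaussian_mixture I "\<lambda>i. exp (real (Suc n) * (r i)\<^sup>2)" "real (Suc n)"
        by unfold_locales (use I in auto)
      have G: "G p x = (\<Sum>i\<in>I. exp (real (Suc n) * ((r i)\<^sup>2 - (norm (x - p i))\<^sup>2)))" for p :: "'i \<Rightarrow> 'a" and x
        unfolding G_def g_def by (simp add: algebra_simps flip: exp_add)
      have phi: "\<phi> a = 1 - exp (- a)" for a unfolding \<phi>_def by simp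
      from integral_mono_expansion[OF dim expansion]
      show "(\<integral>x. 1 - exp (- (\<Sum>i\<in>I. exp (real (Suc n) * ((r i)\<^sup>2 - (norm (x - p i))\<^sup>2)))) \<partial>lborel)
          \<le> (\<integral>x. 1 - exp (- (\<Sum>i\<in>I. exp (real (Suc n) * ((r i)\<^sup>2 - (norm (x - q i))\<^sup>2)))) \<partial>lborel)"
        unfolding G phi .
    qed
  qed
  show "measure lborel (\<Inter>i\<in>I. cball (p i) (r i)) \<ge> measure lborel (\<Inter>i\<in>I. cball (q i) (r i))"
  proof (rule LIMSEQ_le[OF integral_tendsto_measure_INT[OF I r] integral_tendsto_measure_INT[OF I r]],
         goal_cases)
    case 3
    show ?case
    proof (intro exI[of _ 0] allI impI)
      fix n :: nat
      \<comment> \<open>For negative \<open>\<beta>\<close> the function \<open>\<phi>\<close> is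
        \<open>- exp (- a)\<close>, and removing the minus sign reverses the inequality.\<close>
      interpret gaussian_mixture I "\<lambda>i. exp (- real (Suc n) * (r i)\<^sup>2)" "- real (Suc n)"
        by unfold_locales (use I in auto)
      have G: "G p x = (\<Sum>i\<in>I. exp (real (Suc n) * ((norm (x - p i))\<^sup>2 - (r i)\<^sup>2)))" for p :: "'i \<Rightarrow> 'a" and x
        unfolding G_def g_def by (simp add: algebra_simps flip: exp_add)
      have phi: "\<phi> a = - exp (- a)" for a unfolding \<phi>_def by simp
      from integral_mono_expansion[OF dim expansion]
      have "(\<integral>x. - exp (- (\<Sum>i\<in>I. exp (real (Suc n) * ((norm (x - p i))\<^sup>2 - (r i)\<^sup>2)))) \<partial>lborel)
          \<le> (\<integral>x. - exp (- (\<Sum>i\<in>I. exp (real (Suc n) * ((norm (x - q i))\<^sup>2 - (r i)\<^sup>2)))) \<partial>lborel)"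
        unfolding G phi .
      thus "(\<integral>x. exp (- (\<Sum>i\<in>I. exp (real (Suc n) * ((norm (x - q i))\<^sup>2 - (r i)\<^sup>2)))) \<partial>lborel)
          \<le> (\<integral>x. exp (- (\<Sum>i\<in>I. exp (real (Suc n) * ((norm (x - p i))\<^sup>2 - (r i)\<^sup>2)))) \<partial>lborel)"
        by (simp only: integral_minus neg_le_iff_le)
    qed
  qed
qed

theorem corollary1:
  fixes N :: nat
    and p q :: "nat \<Rightarrow> real ^ 2"
    and r :: "nat \<Rightarrow> real"
  assumes expansion: "\<And>i j. 1 \<le> i \<Longrightarrow> i < j \<Longrightarrow> j \<le> N \<Longrightarrow> norm (p i - p j) \<le> norm (q i - q j)"
    and radii: "\<And>i. 1 \<le> i \<Longrightarrow> i \<le> N \<Longrightarrow> 0 \<le> r i"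
  shows "emeasure lborel (\<Union>i\<in>{1..N}. cball (p i) (r i)) \<le> emeasure lborel (\<Union>i\<in>{1..N}. cball (q i) (r i))
       \<and> emeasure lborel (\<Inter>i\<in>{1..N}. cball (p i) (r i)) \<ge> emeasure lborel (\<Inter>i\<in>{1..N}. cball (q i) (r i))"
proof (cases "N = 0")
  \<comment> \<open>For \<open>N = 0\<close> both unions are empty and both intersections are the
    whole plane. Otherwise all four sets are bounded, so \<open>emeasure\<close> can be replaced by
    the real-valued \<open>measure\<close>.\<close>
  case False
  have fin: "emeasure lborel (\<Union>i\<in>{1..N}. cball (p i) (r i)) < \<infinity>" for p :: "nat \<Rightarrow> real ^ 2"
    by (intro emeasure_bounded_finite bounded_UN) auto
  have fin': "emeasure lborel (\<Inter>i\<in>{1..N}. cball (p i) (r i)) < \<infinity>" for p :: "nat \<Rightarrow> real ^ 2"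
    using False by (intro emeasure_bounded_finite bounded_subset[OF bounded_cball[of "p 1" "r 1"]]) auto
  note em = fin[THEN less_imp_neq, unfolded infinity_ennreal_def, THEN emeasure_eq_ennreal_measure]
    fin'[THEN less_imp_neq, unfolded infinity_ennreal_def, THEN emeasure_eq_ennreal_measure]
  have "norm (p i - p j) \<le> norm (q i - q j)" if "i \<in> {1..N}" "j \<in> {1..N}" for i j
    using expansion[of i j] expansion[of j i] that
    by (cases i j rule: linorder_cases) (auto simp: norm_minus_commute)
  from kneser_poulsen_plane[of "{1..N}" r p q, OF _ _ _ _ this] show ?thesis
    using radii False unfolding em by (intro conjI ennreal_leI) auto
qed auto

end
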